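(* Let $P\subseteq\mathbb{R}^d$ be a full-dimensional convex polytope with $0\in P$. Then the intersection body $IP$ of $P$ is a semialgebraic subset of $\mathbb{R}^d$.
   Context: For a convex body (nonempty compact convex set) $K\subset\mathbb{R}^d$, its intersection body is defined via its radial function: for $x\in\mathbb{R}^d\setminus\{0\}$ set $\rho_{IK}(x)=\frac{1}{\|x\|}\operatorname{Vol}_{d-1}(K\cap x^\perp)$, where $x^\perp=\{y:\langle x,y\rangle=0\}$ and $\operatorname{Vol}_{d-1}$ is $(d-1)$-dimensional Euclidean volume, and $IK=\{x\in\mathbb{R}^d\setminus\{0\}:\rho_{IK}(x)\ge 1\}\cup\{0\}$. A set is semialgebraic if it is a finite Boolean combination of sets defined by polynomial inequalities with real coefficients. *)

theory Defs
  imports "HOL-Analysis.Analysis"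
begin

inductive polyfun :: "(real^'n \<Rightarrow> real) \<Rightarrow> bool" where
  const: "polyfun (\<lambda>x. c)"
| coord: "polyfun (\<lambda>x. x $ i)"
| add: "polyfun p \<Longrightarrow> polyfun q \<Longrightarrow> polyfun (\<lambda>x. p x + q x)"
| mult: "polyfun p \<Longrightarrow> polyfun q \<Longrightarrow> polyfun (\<lambda>x. p x * q x)"

inductive semialgebraic :: "(real^'n) set \<Rightarrow> bool" where
  basic_ge: "polyfun p \<Longrightarrow> semialgebraic {x. p x \<ge> 0}"
| basic_gt: "polyfun p \<Longrightarrow> semialgebraic {x. p x > 0}"
| union: "semialgebraic A \<Longrightarrow> semialgebraic B \<Longrightarrow> semialgebraic (A \<union> B)"
| inter: "semialgebraic A \<Longrightarrow> semialgebraic B \<Longrightarrow> semialgebraic (A \<inter> B)"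
| compl: "semialgebraic A \<Longrightarrow> semialgebraic (- A)"

definition orth_hyperplane :: "real^'n \<Rightarrow> (real^'n) set" where
  "orth_hyperplane x = {y. x \<bullet> y = 0}"

text \<open>(d-1)-dimensional volume of a set \<open>S\<close> lying in the hyperplane \<open>x\<^sup>\<perp>\<close>
  (x \<noteq> 0): the d-dimensional Lebesgue volume of the right prism of height 1
  over \<open>S\<close> in direction of the unit normal \<open>x / \<parallel>x\<parallel>\<close> (Cavalieri).\<close>
definition hyperplane_volume :: "real^'n \<Rightarrow> (real^'n) set \<Rightarrow> real" where
  "hyperplane_volume x S =
     measure lebesgue {s + t *\<^sub>R (x /\<^sub>R norm x) | s t. s \<in> S \<and> t \<in> {0..1}}"

definition radial_IB :: "(real^'n) set \<Rightarrow> real^'n \<Rightarrow> real" where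
  "radial_IB K x = hyperplane_volume x (K \<inter> orth_hyperplane x) / norm x"

definition intersection_body :: "(real^'n) set \<Rightarrow> (real^'n) set" where
  "intersection_body K = {x. x \<noteq> 0 \<and> radial_IB K x \<ge> 1} \<union> {0}"

end

theory Submission
  imports Defs
begin

text \<open>
  For \<open>x \<noteq> 0\<close> the prism \<open>Q x = {s + t x | s \<in> P \<inter> x\<^sup>\<perp>, 0 \<le> t \<le> 1}\<close> has volume
  \<open>V x = \<parallel>x\<parallel>\<^sup>2 \<rho> x\<close>, where \<open>\<rho>\<close> is the radial function of the intersection body, so the
  condition \<open>\<rho> x \<ge> 1\<close> reads \<open>V x \<ge> x \<bullet> x\<close> and no square root is left. Multiplying the
  inequalities of \<open>P\<close> at the orthogonal projection of \<open>w\<close> by \<open>x \<bullet> x\<close> describes \<open>w \<in> Q x\<close> by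
  inequalities that are affine in \<open>w\<close> with coefficients polynomial in \<open>x\<close>. The indicator of \<open>Q x\<close>
  is integrated one coordinate of \<open>w\<close> at a time. Consider functions that are piecewise polynomial
  in \<open>w\<close>, with pieces cut out by affine inequalities in \<open>w\<close> and all coefficients piecewise
  rational in \<open>x\<close>. They have continuous primitives of the same kind in every coordinate, because
  an affine condition either does not involve the coordinate or compares it with a threshold that
  is again affine in the others. Hence \<open>V\<close> is piecewise rational on semialgebraic pieces.
\<close>

section \<open>Piecewise rational functions\<close>

lemma polyfun_sum:
  assumes "\<And>i. i \<in> I \<Longrightarrow> polyfun (p i)"
  shows "polyfun (\<lambda>x. \<Sum>i\<in>I. p i x)"
  using assms by (induction I rule: infinite_finite_induct) (auto intro: polyfun.intros)

lemma polyfun_minus: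
  assumes "polyfun p"
  shows "polyfun (\<lambda>x. - p x)"
  using polyfun.mult[OF polyfun.const[of "-1"] assms] by simp

lemma polyfun_diff:
  assumes "polyfun p" "polyfun q"
  shows "polyfun (\<lambda>x. p x - q x)"
  using polyfun.add[OF assms(1) polyfun_minus[OF assms(2)]] by simp

lemma polyfun_inner:
  assumes "\<And>i. polyfun (\<lambda>x. f x $ i)" "\<And>i. polyfun (\<lambda>x. g x $ i)"
  shows "polyfun (\<lambda>x. f x \<bullet> g x)"
  unfolding inner_vec_def inner_real_def by (intro polyfun_sum polyfun.mult assms)

lemma semialgebraic_zero_set:
  assumes "polyfun p"
  shows "semialgebraic {x. p x = 0}"
proof -
  have "semialgebraic ({x. p x \<ge> 0} \<inter> {x. - p x \<ge> 0})"
    by (intro semialgebraic.inter semialgebraic.basic_ge polyfun_minus assms)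
  also have "{x. p x \<ge> 0} \<inter> {x. - p x \<ge> 0} = {x. p x = 0}" by auto
  finally show ?thesis .
qed

lemma semialgebraic_singleton_zero: "semialgebraic {0 :: real^'n}"
proof -
  have "semialgebraic {x :: real^'n. x \<bullet> x = 0}"
    by (intro semialgebraic_zero_set polyfun_inner polyfun.coord)
  then show ?thesis by simp
qed

text \<open>Thanks to \<open>p / 0 = 0\<close> this class is closed under division without a case distinction.\<close>

inductive piecewise_rational :: "(real^'n \<Rightarrow> real) \<Rightarrow> bool" where
  quotient: "polyfun p \<Longrightarrow> polyfun q \<Longrightarrow> piecewise_rational (\<lambda>x. p x / q x)"
| glue: "semialgebraic A \<Longrightarrow> piecewise_rational f \<Longrightarrow> piecewise_rational g \<Longrightarrow>
    piecewise_rational (\<lambda>x. if x \<in> A then f x else g x)"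

lemma polyfun_imp_piecewise_rational:
  assumes "polyfun p"
  shows "piecewise_rational p"
  using piecewise_rational.quotient[OF assms polyfun.const[of 1]] by simp

lemma piecewise_rational_binop:
  fixes f g :: "real^'n \<Rightarrow> real" and h :: "real \<Rightarrow> real \<Rightarrow> real"
  assumes "piecewise_rational f" "piecewise_rational g"
    and quotients: "\<And>p q r s :: real^'n \<Rightarrow> real. \<lbrakk>polyfun p; polyfun q; polyfun r; polyfun s\<rbrakk> \<Longrightarrow>
      piecewise_rational (\<lambda>x. h (p x / q x) (r x / s x))"
  shows "piecewise_rational (\<lambda>x. h (f x) (g x))"
  using assms(1)
proof induction
  case f: (quotient p q)
  show ?case
    using assms(2)
  proof induction
    case (quotient r s)
    with f show ?case by (intro quotients)
  next
    case (glue A f g)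
    then show ?case
      using piecewise_rational.glue by (simp add: if_distrib[of "h _"])
  qed
next
  case (glue A f f')
  then show ?case
    using piecewise_rational.glue by (simp add: if_distribR if_distrib[of h])
qed

lemma piecewise_rational_add:
  assumes "piecewise_rational f" "piecewise_rational g"
  shows "piecewise_rational (\<lambda>x. f x + g x)"
proof (rule piecewise_rational_binop[OF assms])
  fix p q r s :: "real^'n \<Rightarrow> real"
  assume poly: "polyfun p" "polyfun q" "polyfun r" "polyfun s"
  let ?sum = "\<lambda>x. if x \<in> {x. q x = 0} then r x / s x
    else if x \<in> {x. s x = 0} then p x / q x
    else (p x * s x + r x * q x) / (q x * s x)"
  have "piecewise_rational ?sum"
    by (intro piecewise_rational.intros semialgebraic_zero_set polyfun.add polyfun.mult poly)
  also have "?sum = (\<lambda>x. p x / q x + r x / s x)"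
    by (auto simp: fun_eq_iff field_simps)
  finally show "piecewise_rational (\<lambda>x. p x / q x + r x / s x)" .
qed

lemma piecewise_rational_mult:
  assumes "piecewise_rational f" "piecewise_rational g"
  shows "piecewise_rational (\<lambda>x. f x * g x)"
  using assms
  by (rule piecewise_rational_binop) (auto intro!: piecewise_rational.quotient polyfun.mult)

lemma piecewise_rational_divide:
  assumes "piecewise_rational f" "piecewise_rational g"
  shows "piecewise_rational (\<lambda>x. f x / g x)"
  using assms
  by (rule piecewise_rational_binop) (auto intro!: piecewise_rational.quotient polyfun.mult)

lemma semialgebraic_piecewise_rational_pos:
  assumes "piecewise_rational f"
  shows "semialgebraic {x. f x > 0}"
  using assms
proof induction
  case (quotient p q)
  have "{x. p x / q x > 0} = {x. p x * q x > 0}"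
    by (auto simp: zero_less_divide_iff zero_less_mult_iff)
  with quotient show ?case by (simp add: semialgebraic.intros polyfun.mult)
next
  case (glue A f g)
  have "{x. (if x \<in> A then f x else g x) > 0} =
    (A \<inter> {x. f x > 0}) \<union> (- A \<inter> {x. g x > 0})" by auto
  with glue show ?case by (simp add: semialgebraic.intros)
qed

lemma semialgebraic_piecewise_rational_le:
  assumes "piecewise_rational f" "piecewise_rational g"
  shows "semialgebraic {x. f x \<le> g x}"
proof -
  have "piecewise_rational (\<lambda>x. f x + -1 * g x)"
    by (intro piecewise_rational_add piecewise_rational_mult
        polyfun_imp_piecewise_rational[of "\<lambda>x. -1"] polyfun.const assms)
  then have "semialgebraic (- {x. f x + -1 * g x > 0})"
    by (intro semialgebraic.compl semialgebraic_piecewise_rational_pos)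
  also have "- {x. f x + -1 * g x > 0} = {x. f x \<le> g x}" by auto
  finally show ?thesis .
qed

section \<open>Piecewise primitives\<close>

definition piecewise_primitive :: "(real \<Rightarrow> real) \<Rightarrow> (real \<Rightarrow> real) \<Rightarrow> bool" where
  "piecewise_primitive f g \<longleftrightarrow> continuous_on UNIV g \<and>
    (\<exists>S. finite S \<and> (\<forall>t. t \<notin> S \<longrightarrow> (g has_real_derivative f t) (at t)))"

lemma primitive_imp_piecewise_primitive:
  assumes "\<And>t. (g has_real_derivative f t) (at t)"
  shows "piecewise_primitive f g"
  unfolding piecewise_primitive_def
  using assms by (meson DERIV_continuous continuous_at_imp_continuous_on finite.emptyI)

lemma piecewise_primitive_has_integral:
  assumes "piecewise_primitive f g" "a \<le> b"
  shows "(f has_integral g b - g a) {a..b}"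
proof -
  obtain S where "finite S" "\<And>t. t \<notin> S \<Longrightarrow> (g has_real_derivative f t) (at t)"
    using assms(1) unfolding piecewise_primitive_def by blast
  moreover have "continuous_on {a..b} g"
    using assms(1) continuous_on_subset unfolding piecewise_primitive_def by blast
  ultimately show ?thesis
    using assms(2)
    by (intro fundamental_theorem_of_calculus_interior_strong)
      (auto simp: has_real_derivative_iff_has_vector_derivative)
qed

lemma piecewise_primitive_add_const:
  assumes "piecewise_primitive f g"
  shows "piecewise_primitive f (\<lambda>t. g t + k)"
proof -
  have "((\<lambda>t. g t + k) has_real_derivative f t) (at t)"
    if "(g has_real_derivative f t) (at t)" for t
    using DERIV_add[OF that DERIV_const[of k]] by simp
  moreover have "continuous_on UNIV (\<lambda>t. g t + k)"
    using assms unfolding piecewise_primitive_def by (intro continuous_intros) simp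
  ultimately show ?thesis
    using assms unfolding piecewise_primitive_def by blast
qed

lemma has_real_derivative_If_pos:
  fixes c d :: real
  assumes "c * t + d \<noteq> 0"
    and "c * t + d > 0 \<Longrightarrow> (g\<^sub>1 has_real_derivative D\<^sub>1) (at t)"
    and "c * t + d < 0 \<Longrightarrow> (g\<^sub>2 has_real_derivative D\<^sub>2) (at t)"
  shows "((\<lambda>t. if c * t + d > 0 then g\<^sub>1 t else g\<^sub>2 t) has_real_derivative
    (if c * t + d > 0 then D\<^sub>1 else D\<^sub>2)) (at t)"
    (is "(?g has_real_derivative _) _")
proof (cases "c * t + d > 0")
  case True
  have "open {t. c * t + d > 0}" by (intro open_Collect_less continuous_intros)
  with True assms(2) show ?thesis
    using has_field_derivative_transform_within_open[of g\<^sub>1 D\<^sub>1 t "{t. c * t + d > 0}" ?g]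
    by simp
next
  case False
  have "open {t. c * t + d < 0}" by (intro open_Collect_less continuous_intros)
  with False assms(1,3) show ?thesis
    using has_field_derivative_transform_within_open[of g\<^sub>2 D\<^sub>2 t "{t. c * t + d < 0}" ?g]
    by simp
qed

lemma piecewise_primitive_glue:
  fixes c d :: real
  assumes "piecewise_primitive f\<^sub>1 g\<^sub>1" "piecewise_primitive f\<^sub>2 g\<^sub>2"
    and "c \<noteq> 0" and agree: "\<And>t. c * t + d = 0 \<Longrightarrow> g\<^sub>1 t = g\<^sub>2 t"
  shows "piecewise_primitive (\<lambda>t. if c * t + d > 0 then f\<^sub>1 t else f\<^sub>2 t)
    (\<lambda>t. if c * t + d > 0 then g\<^sub>1 t else g\<^sub>2 t)"
proof -
  let ?f = "\<lambda>t. if c * t + d > 0 then f\<^sub>1 t else f\<^sub>2 t"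
  let ?g = "\<lambda>t. if c * t + d > 0 then g\<^sub>1 t else g\<^sub>2 t"
  obtain S\<^sub>1 where g\<^sub>1: "continuous_on UNIV g\<^sub>1" "finite S\<^sub>1"
    "\<And>t. t \<notin> S\<^sub>1 \<Longrightarrow> (g\<^sub>1 has_real_derivative f\<^sub>1 t) (at t)"
    using assms(1) unfolding piecewise_primitive_def by blast
  obtain S\<^sub>2 where g\<^sub>2: "continuous_on UNIV g\<^sub>2" "finite S\<^sub>2"
    "\<And>t. t \<notin> S\<^sub>2 \<Longrightarrow> (g\<^sub>2 has_real_derivative f\<^sub>2 t) (at t)"
    using assms(2) unfolding piecewise_primitive_def by blast
  have "continuous_on UNIV (\<lambda>t. if c * t + d \<le> 0 then g\<^sub>2 t else g\<^sub>1 t)"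
    using g\<^sub>1(1) g\<^sub>2(1) agree
    by (intro continuous_on_cases_le continuous_intros) (auto intro: continuous_on_subset)
  also have "(\<lambda>t. if c * t + d \<le> 0 then g\<^sub>2 t else g\<^sub>1 t) = ?g" by auto
  finally have "continuous_on UNIV ?g" .
  moreover have "(?g has_real_derivative ?f t) (at t)"
    if "t \<notin> S\<^sub>1 \<union> S\<^sub>2 \<union> {- d / c}" for t
  proof (rule has_real_derivative_If_pos)
    show "c * t + d \<noteq> 0" using that \<open>c \<noteq> 0\<close> by (auto simp: field_simps eq_neg_iff_add_eq_0)
  qed (use that g\<^sub>1(3) g\<^sub>2(3) in auto)
  ultimately show ?thesis
    unfolding piecewise_primitive_def using g\<^sub>1(2) g\<^sub>2(2)
    by (intro conjI exI[of _ "S\<^sub>1 \<union> S\<^sub>2 \<union> {- d / c}"]) auto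
qed

text \<open>For \<open>c \<noteq> 0\<close> the condition changes at \<open>m\<close>, and the constants make both branches agree there;
  for \<open>c = 0\<close> the condition is constant and the constants are harmless.\<close>

lemma piecewise_primitive_If_pos:
  fixes c d :: real
  assumes "piecewise_primitive f\<^sub>1 g\<^sub>1" "piecewise_primitive f\<^sub>2 g\<^sub>2"
  defines "m \<equiv> - inverse c * d"
  shows "piecewise_primitive (\<lambda>t. if c * t + d > 0 then f\<^sub>1 t else f\<^sub>2 t)
    (\<lambda>t. if c * t + d > 0 then g\<^sub>1 t - g\<^sub>1 m + g\<^sub>2 m else g\<^sub>2 t)"
proof -
  have g\<^sub>1: "piecewise_primitive f\<^sub>1 (\<lambda>t. g\<^sub>1 t - g\<^sub>1 m + g\<^sub>2 m)"
    using piecewise_primitive_add_const[OF assms(1), of "g\<^sub>2 m - g\<^sub>1 m"]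
    by (simp add: algebra_simps)
  show ?thesis
  proof (cases "c = 0")
    case True
    with g\<^sub>1 assms(2) show ?thesis by (cases "d > 0") simp_all
  next
    case False
    then have "t = m" if "c * t + d = 0" for t
      using that by (simp add: m_def field_simps eq_neg_iff_add_eq_0)
    with False show ?thesis by (intro piecewise_primitive_glue g\<^sub>1 assms(2)) auto
  qed
qed

section \<open>Piecewise polynomials with parametrised coefficients\<close>

locale piecewise_field =
  fixes coefficient :: "('x \<Rightarrow> real) \<Rightarrow> bool"
  assumes coefficient_const: "coefficient (\<lambda>x. r)"
    and coefficient_add: "coefficient f \<Longrightarrow> coefficient g \<Longrightarrow> coefficient (\<lambda>x. f x + g x)"
    and coefficient_mult: "coefficient f \<Longrightarrow> coefficient g \<Longrightarrow> coefficient (\<lambda>x. f x * g x)"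
    and coefficient_inverse: "coefficient f \<Longrightarrow> coefficient (\<lambda>x. inverse (f x))"
    and coefficient_If_pos: "coefficient c \<Longrightarrow> coefficient f \<Longrightarrow> coefficient g \<Longrightarrow>
      coefficient (\<lambda>x. if c x > 0 then f x else g x)"
begin

lemma coefficient_minus:
  assumes "coefficient f"
  shows "coefficient (\<lambda>x. - f x)"
  using coefficient_mult[OF coefficient_const[of "-1"] assms] by simp

text \<open>In the following classes the first argument is the parameter, the second one the variable.\<close>

inductive affine_family :: "('x \<Rightarrow> ('i \<Rightarrow> real) \<Rightarrow> real) \<Rightarrow> bool" where
  const: "coefficient c \<Longrightarrow> affine_family (\<lambda>x y. c x)"
| coord: "coefficient c \<Longrightarrow> affine_family (\<lambda>x y. c x * y i)"
| add: "affine_family L \<Longrightarrow> affine_family M \<Longrightarrow> affine_family (\<lambda>x y. L x y + M x y)"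

lemma affine_family_scale:
  assumes "affine_family L" "coefficient c"
  shows "affine_family (\<lambda>x y. c x * L x y)"
  using assms(1)
proof induction
  case (const d)
  then show ?case by (intro affine_family.const coefficient_mult assms(2))
next
  case (coord d i)
  then have "affine_family (\<lambda>x y. (c x * d x) * y i)"
    by (intro affine_family.coord coefficient_mult assms(2))
  then show ?case by (simp add: mult.assoc)
qed (simp add: distrib_left affine_family.add)

lemma affine_family_diff:
  assumes "affine_family L" "affine_family M"
  shows "affine_family (\<lambda>x y. L x y - M x y)"
  using affine_family.add[OF assms(1) affine_family_scale[OF assms(2) coefficient_const[of "-1"]]]
  by simp

lemma affine_family_coordinate: "affine_family (\<lambda>x y. y i)"
  using affine_family.coord[OF coefficient_const[of 1]] by simp

lemma affine_family_subst:
  assumes "affine_family L" "affine_family u"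
  shows "affine_family (\<lambda>x y. L x (y(i := u x y)))"
  using assms(1)
proof induction
  case (coord c j)
  then show ?case
    by (cases "j = i") (auto intro: affine_family_scale assms(2) affine_family.coord)
qed (auto intro: affine_family.intros)

lemma affine_family_in_coordinate:
  assumes "affine_family L"
  shows "\<exists>c. coefficient c \<and> (\<forall>x y t. L x (y(i := t)) = c x * t + L x (y(i := 0)))"
  using assms
proof induction
  case (const c)
  show ?case by (intro exI[of _ "\<lambda>x. 0"]) (simp add: coefficient_const)
next
  case (coord c j)
  then show ?case
    by (cases "j = i")
      (auto intro!: exI[of _ "if j = i then c else (\<lambda>x. 0)"] simp: coefficient_const)
next
  case (add L M)
  obtain c where c: "coefficient c" "\<And>x y t. L x (y(i := t)) = c x * t + L x (y(i := 0))"
    using add.IH(1) by blast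
  obtain d where d: "coefficient d" "\<And>x y t. M x (y(i := t)) = d x * t + M x (y(i := 0))"
    using add.IH(2) by blast
  show ?case
  proof (intro exI[of _ "\<lambda>x. c x + d x"] conjI allI)
    show "L x (y(i := t)) + M x (y(i := t)) =
        (c x + d x) * t + (L x (y(i := 0)) + M x (y(i := 0)))" for x y t
      by (subst c(2), subst d(2)) (simp add: distrib_right)
  qed (intro coefficient_add c(1) d(1))
qed

lemma affine_family_inner:
  fixes a :: "'x \<Rightarrow> real^'n"
  assumes "\<And>i. coefficient (\<lambda>x. a x $ i)"
  shows "affine_family (\<lambda>x y. a x \<bullet> vec_lambda y)"
proof -
  have "affine_family (\<lambda>x y. \<Sum>i\<in>I. a x $ i * y i)" for I
    by (induction I rule: infinite_finite_induct)
      (simp_all add: affine_family.intros coefficient_const assms)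
  then show ?thesis by (simp add: inner_vec_def)
qed

text \<open>Building monomials one factor at a time lets primitives be found by structural induction.\<close>

inductive polynomial_family :: "('x \<Rightarrow> ('i \<Rightarrow> real) \<Rightarrow> real) \<Rightarrow> bool" where
  const: "coefficient c \<Longrightarrow> polynomial_family (\<lambda>x y. c x)"
| coord_mult: "polynomial_family F \<Longrightarrow> polynomial_family (\<lambda>x y. y i * F x y)"
| add: "polynomial_family F \<Longrightarrow> polynomial_family G \<Longrightarrow> polynomial_family (\<lambda>x y. F x y + G x y)"

lemma polynomial_family_scale:
  assumes "polynomial_family F" "coefficient c"
  shows "polynomial_family (\<lambda>x y. c x * F x y)"
  using assms(1)
proof induction
  case (const d)
  then show ?case by (intro polynomial_family.const coefficient_mult assms(2))
next
  case (coord_mult F i)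
  then show ?case using polynomial_family.coord_mult[of _ i] by (simp add: mult.left_commute)
qed (simp add: distrib_left polynomial_family.add)

lemma polynomial_family_mult:
  assumes "polynomial_family F" "polynomial_family G"
  shows "polynomial_family (\<lambda>x y. F x y * G x y)"
  using assms(1)
  by induction
    (auto simp: mult.assoc distrib_right
      intro: polynomial_family.intros polynomial_family_scale assms(2))

lemma polynomial_family_diff:
  assumes "polynomial_family F" "polynomial_family G"
  shows "polynomial_family (\<lambda>x y. F x y - G x y)"
  using polynomial_family.add[OF assms(1)
      polynomial_family_scale[OF assms(2) coefficient_const[of "-1"]]] by simp

lemma polynomial_family_subst:
  assumes "polynomial_family F" "polynomial_family u"
  shows "polynomial_family (\<lambda>x y. F x (y(i := u x y)))"
  using assms(1)
proof induction
  case (coord_mult F j)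
  then show ?case
    by (cases "j = i") (auto intro: polynomial_family_mult assms(2) polynomial_family.coord_mult)
qed (auto intro: polynomial_family.intros)

lemma affine_imp_polynomial_family:
  assumes "affine_family L"
  shows "polynomial_family L"
  using assms
proof induction
  case (coord c i)
  then show ?case
    using polynomial_family.coord_mult[OF polynomial_family.const, of c i]
    by (simp add: mult.commute)
qed (auto intro: polynomial_family.intros)

lemma polynomial_family_monomial:
  assumes "coefficient c"
  shows "polynomial_family (\<lambda>x y. y i ^ k * c x)"
  using assms by (induction k) (simp_all add: mult.assoc polynomial_family.intros)

lemma polynomial_family_monomial_mult_primitive:
  assumes "polynomial_family F"
  shows "\<exists>G. polynomial_family G \<and>
    (\<forall>x y t. ((\<lambda>t. G x (y(i := t))) has_real_derivative t ^ k * F x (y(i := t))) (at t))"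
  using assms
proof (induction arbitrary: k)
  case (const c)
  then have "polynomial_family (\<lambda>x y. y i ^ Suc k * (c x * inverse (real (Suc k))))"
    by (intro polynomial_family_monomial coefficient_mult coefficient_const)
  moreover have "((\<lambda>t. t ^ Suc k * (c x * inverse (real (Suc k))))
      has_real_derivative t ^ k * c x) (at t)" for x t
    by (rule derivative_eq_intros refl | simp add: field_simps del: of_nat_Suc)+
  ultimately show ?case by (intro exI conjI) auto
next
  case (coord_mult F j)
  show ?case
  proof (cases "j = i")
    case True
    then show ?thesis using coord_mult.IH[of "Suc k"] by (simp add: mult.left_commute mult.assoc)
  next
    case False
    obtain G where "polynomial_family G"
      "\<And>x y t. ((\<lambda>t. G x (y(i := t))) has_real_derivative t ^ k * F x (y(i := t))) (at t)"
      using coord_mult.IH by blast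
    with False show ?thesis
      by (intro exI[of _ "\<lambda>x y. y j * G x y"])
        (auto simp: mult.left_commute intro: polynomial_family.coord_mult DERIV_cmult
          simp del: fun_upd_apply simp add: fun_upd_other)
  qed
next
  case (add F\<^sub>1 F\<^sub>2)
  then obtain G\<^sub>1 G\<^sub>2 where "polynomial_family G\<^sub>1" "polynomial_family G\<^sub>2"
    "\<And>x y t. ((\<lambda>t. G\<^sub>1 x (y(i := t))) has_real_derivative t ^ k * F\<^sub>1 x (y(i := t))) (at t)"
    "\<And>x y t. ((\<lambda>t. G\<^sub>2 x (y(i := t))) has_real_derivative t ^ k * F\<^sub>2 x (y(i := t))) (at t)"
    by metis
  then show ?case
    by (intro exI[of _ "\<lambda>x y. G\<^sub>1 x y + G\<^sub>2 x y"])
      (auto simp: distrib_left intro: polynomial_family.add DERIV_add simp del: fun_upd_apply)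
qed

inductive piecewise_polynomial_family :: "('x \<Rightarrow> ('i \<Rightarrow> real) \<Rightarrow> real) \<Rightarrow> bool" where
  polynomial: "polynomial_family F \<Longrightarrow> piecewise_polynomial_family F"
| If_pos: "affine_family L \<Longrightarrow> piecewise_polynomial_family F \<Longrightarrow> piecewise_polynomial_family G \<Longrightarrow>
    piecewise_polynomial_family (\<lambda>x y. if L x y > 0 then F x y else G x y)"

lemma piecewise_polynomial_family_const: "piecewise_polynomial_family (\<lambda>x y. r)"
  by (intro piecewise_polynomial_family.polynomial polynomial_family.const coefficient_const)

lemma piecewise_polynomial_family_binop:
  fixes F G :: "'x \<Rightarrow> ('i \<Rightarrow> real) \<Rightarrow> real" and h :: "real \<Rightarrow> real \<Rightarrow> real"
  assumes "piecewise_polynomial_family F" "piecewise_polynomial_family G"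
    and polynomials: "\<And>F G :: 'x \<Rightarrow> ('i \<Rightarrow> real) \<Rightarrow> real. polynomial_family F \<Longrightarrow> polynomial_family G \<Longrightarrow>
      polynomial_family (\<lambda>x y. h (F x y) (G x y))"
  shows "piecewise_polynomial_family (\<lambda>x y. h (F x y) (G x y))"
  using assms(1)
proof induction
  case F: (polynomial F)
  show ?case
    using assms(2)
  proof induction
    case (polynomial G)
    with F show ?case by (intro piecewise_polynomial_family.polynomial polynomials)
  next
    case (If_pos L G\<^sub>1 G\<^sub>2)
    then show ?case
      using piecewise_polynomial_family.If_pos by (simp add: if_distrib[of "h _"])
  qed
next
  case (If_pos L F\<^sub>1 F\<^sub>2)
  then show ?case
    using piecewise_polynomial_family.If_pos by (simp add: if_distribR if_distrib[of h])
qed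

lemma piecewise_polynomial_family_add:
  assumes "piecewise_polynomial_family F" "piecewise_polynomial_family G"
  shows "piecewise_polynomial_family (\<lambda>x y. F x y + G x y)"
  using assms by (rule piecewise_polynomial_family_binop) (rule polynomial_family.add)

lemma piecewise_polynomial_family_diff:
  assumes "piecewise_polynomial_family F" "piecewise_polynomial_family G"
  shows "piecewise_polynomial_family (\<lambda>x y. F x y - G x y)"
  using assms by (rule piecewise_polynomial_family_binop) (rule polynomial_family_diff)

lemma piecewise_polynomial_family_subst:
  assumes "piecewise_polynomial_family F" "affine_family u"
  shows "piecewise_polynomial_family (\<lambda>x y. F x (y(i := u x y)))"
  using assms(1)
proof induction
  case (polynomial F)
  then show ?case
    using assms(2)
    by (intro piecewise_polynomial_family.polynomial polynomial_family_subst[of F u]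
        affine_imp_polynomial_family[of u])
next
  case (If_pos L F G)
  then show ?case by (intro piecewise_polynomial_family.If_pos affine_family_subst assms(2))
qed

lemma piecewise_polynomial_family_If_nonpos:
  assumes "finite K" "\<And>k. k \<in> K \<Longrightarrow> affine_family (L k)" "piecewise_polynomial_family F"
  shows "piecewise_polynomial_family (\<lambda>x y. if \<forall>k\<in>K. L k x y \<le> 0 then F x y else 0)"
  using assms(1,2)
proof (induction K)
  case empty
  then show ?case using assms(3) by simp
next
  case (insert k K)
  then have "piecewise_polynomial_family
      (\<lambda>x y. if L k x y > 0 then 0 else if \<forall>k\<in>K. L k x y \<le> 0 then F x y else 0)"
    by (intro piecewise_polynomial_family.If_pos piecewise_polynomial_family_const) auto
  also have "(\<lambda>x y. if L k x y > 0 then 0 else if \<forall>k\<in>K. L k x y \<le> 0 then F x y else 0) =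
      (\<lambda>x y. if \<forall>k\<in>insert k K. L k x y \<le> 0 then F x y else 0)"
    by (auto simp: fun_eq_iff)
  finally show ?case .
qed

lemma polynomial_family_coefficient:
  assumes "polynomial_family F"
  shows "coefficient (\<lambda>x. F x y)"
  using assms by induction (simp_all add: coefficient_add coefficient_mult coefficient_const)

lemma piecewise_polynomial_family_coefficient:
  assumes "piecewise_polynomial_family F"
  shows "coefficient (\<lambda>x. F x y)"
  using assms
  by induction
    (simp_all add: coefficient_If_pos polynomial_family_coefficient affine_imp_polynomial_family)

lemma polynomial_family_measurable:
  assumes "polynomial_family F" "\<And>i. (\<lambda>z. g z i) \<in> borel_measurable N"
  shows "(\<lambda>z. F x (g z)) \<in> borel_measurable N"
  using assms by induction auto

lemma piecewise_polynomial_family_measurable: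
  assumes "piecewise_polynomial_family F" and g: "\<And>i. (\<lambda>z. g z i) \<in> borel_measurable N"
  shows "(\<lambda>z. F x (g z)) \<in> borel_measurable N"
  using assms(1)
proof induction
  case (If_pos L F G)
  have [measurable]: "(\<lambda>z. L x (g z)) \<in> borel_measurable N"
    by (rule polynomial_family_measurable[OF affine_imp_polynomial_family[OF If_pos.hyps(1)] g])
  note If_pos.IH[measurable]
  show ?case by measurable
qed (rule polynomial_family_measurable[OF _ g])

lemma piecewise_polynomial_family_primitive_If_pos:
  assumes L: "affine_family L"
    and G\<^sub>1: "piecewise_polynomial_family G\<^sub>1"
      "\<And>x y. piecewise_primitive (\<lambda>t. F\<^sub>1 x (y(i := t))) (\<lambda>t. G\<^sub>1 x (y(i := t)))"
    and G\<^sub>2: "piecewise_polynomial_family G\<^sub>2"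
      "\<And>x y. piecewise_primitive (\<lambda>t. F\<^sub>2 x (y(i := t))) (\<lambda>t. G\<^sub>2 x (y(i := t)))"
  shows "\<exists>G. piecewise_polynomial_family G \<and> (\<forall>x y. piecewise_primitive
    (\<lambda>t. if L x (y(i := t)) > 0 then F\<^sub>1 x (y(i := t)) else F\<^sub>2 x (y(i := t)))
    (\<lambda>t. G x (y(i := t))))"
proof -
  obtain c where c: "coefficient c" "\<And>x y t. L x (y(i := t)) = c x * t + L x (y(i := 0))"
    using affine_family_in_coordinate[OF L] by blast
  define m where "m x y = - inverse (c x) * L x (y(i := 0))" for x y
  have m: "affine_family m"
    unfolding m_def
    by (intro affine_family_scale affine_family_subst[OF L] affine_family.const
        coefficient_minus coefficient_inverse coefficient_const c(1))
  define G where "G x y = (if L x y > 0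
      then G\<^sub>1 x y - G\<^sub>1 x (y(i := m x y)) + G\<^sub>2 x (y(i := m x y)) else G\<^sub>2 x y)" for x y
  show ?thesis
  proof (intro exI[of _ G] conjI allI)
    show "piecewise_polynomial_family G"
      unfolding G_def
      by (intro piecewise_polynomial_family.If_pos piecewise_polynomial_family_add
          piecewise_polynomial_family_diff piecewise_polynomial_family_subst[OF G\<^sub>1(1) m]
          piecewise_polynomial_family_subst[OF G\<^sub>2(1) m] L G\<^sub>1(1) G\<^sub>2(1))
    fix x y
    have "m x (y(i := t)) = m x y" for t by (simp add: m_def del: fun_upd_apply)
    then show "piecewise_primitive
        (\<lambda>t. if L x (y(i := t)) > 0 then F\<^sub>1 x (y(i := t)) else F\<^sub>2 x (y(i := t)))
        (\<lambda>t. G x (y(i := t)))"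
      using piecewise_primitive_If_pos[OF G\<^sub>1(2) G\<^sub>2(2), of "c x" "L x (y(i := 0))" x y x y]
      by (simp only: G_def c(2)[symmetric] m_def[symmetric] fun_upd_upd)
  qed
qed

lemma piecewise_polynomial_family_primitive:
  assumes "piecewise_polynomial_family F"
  shows "\<exists>G. piecewise_polynomial_family G \<and>
    (\<forall>x y. piecewise_primitive (\<lambda>t. F x (y(i := t))) (\<lambda>t. G x (y(i := t))))"
  using assms
proof induction
  case (polynomial F)
  then obtain G where G: "polynomial_family G"
    "\<And>x y t. ((\<lambda>t. G x (y(i := t))) has_real_derivative F x (y(i := t))) (at t)"
    using polynomial_family_monomial_mult_primitive[of F i 0] by auto
  show ?case
    by (intro exI[of _ G] conjI allI piecewise_polynomial_family.polynomial
        primitive_imp_piecewise_primitive G)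
next
  case (If_pos L F\<^sub>1 F\<^sub>2)
  obtain G\<^sub>1 where G\<^sub>1: "piecewise_polynomial_family G\<^sub>1"
    "\<And>x y. piecewise_primitive (\<lambda>t. F\<^sub>1 x (y(i := t))) (\<lambda>t. G\<^sub>1 x (y(i := t)))"
    using If_pos.IH(1) by blast
  obtain G\<^sub>2 where G\<^sub>2: "piecewise_polynomial_family G\<^sub>2"
    "\<And>x y. piecewise_primitive (\<lambda>t. F\<^sub>2 x (y(i := t))) (\<lambda>t. G\<^sub>2 x (y(i := t)))"
    using If_pos.IH(2) by blast
  from If_pos.hyps(1) G\<^sub>1 G\<^sub>2 show ?case by (rule piecewise_polynomial_family_primitive_If_pos)
qed

lemma piecewise_polynomial_family_nn_integral:
  assumes F: "piecewise_polynomial_family F" "\<And>x y. F x y \<ge> 0"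
    and R: "coefficient R" "\<And>x. R x \<ge> 0" "\<And>x y. \<bar>y i\<bar> > R x \<Longrightarrow> F x y = 0"
  obtains T where "piecewise_polynomial_family T" "\<And>x y. T x y \<ge> 0"
    "\<And>x y. (\<integral>\<^sup>+t. F x (y(i := t)) \<partial>lborel) = T x y"
proof -
  obtain G where G: "piecewise_polynomial_family G"
    "\<And>x y. piecewise_primitive (\<lambda>t. F x (y(i := t))) (\<lambda>t. G x (y(i := t)))"
    using piecewise_polynomial_family_primitive[OF F(1)] by blast
  define T where "T x y = G x (y(i := R x)) - G x (y(i := - R x))" for x y
  have integral: "((\<lambda>t. F x (y(i := t))) has_integral T x y) UNIV" for x y
  proof (rule has_integral_on_superset)
    show "((\<lambda>t. F x (y(i := t))) has_integral T x y) {- R x..R x}"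
      unfolding T_def using R(2)[of x] by (intro piecewise_primitive_has_integral G) simp
  qed (auto intro!: R(3))
  show thesis
  proof (rule that[of T])
    show "piecewise_polynomial_family T"
      unfolding T_def
      by (intro piecewise_polynomial_family_diff piecewise_polynomial_family_subst[OF G(1)]
          affine_family.const coefficient_minus R(1))
    show "T x y \<ge> 0" for x y
      using has_integral_nonneg[OF integral] F(2) by blast
    show "(\<integral>\<^sup>+t. F x (y(i := t)) \<partial>lborel) = T x y" for x y
    proof (rule nn_integral_has_integral_lborel[OF _ _ integral])
      show "(\<lambda>t. F x (y(i := t))) \<in> borel_measurable borel"
        by (rule piecewise_polynomial_family_measurable[OF F(1)]) (simp add: fun_upd_def)
    qed (rule F(2))
  qed
qed

lemma override_on_measurable_PiM:
  "(\<lambda>z. override_on y z J i) \<in> borel_measurable (PiM J (\<lambda>_. lborel))"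
  by (cases "i \<in> J") (simp_all add: override_on_def)

lemma piecewise_polynomial_family_nn_integral_PiM:
  assumes "finite J" and F: "piecewise_polynomial_family F" "\<And>x y. F x y \<ge> 0"
    and R: "coefficient R" "\<And>x. R x \<ge> 0" "\<And>x y j. j \<in> J \<Longrightarrow> \<bar>y j\<bar> > R x \<Longrightarrow> F x y = 0"
  shows "\<exists>T. piecewise_polynomial_family T \<and> (\<forall>x y. T x y \<ge> 0 \<and>
    (\<integral>\<^sup>+z. F x (override_on y z J) \<partial>PiM J (\<lambda>_. lborel)) = T x y)"
  using assms(1) R(3)
proof (induction J)
  case empty
  show ?case
    using F by (intro exI[of _ F]) (simp add: PiM_empty)
next
  case (insert i J)
  interpret product_sigma_finite "\<lambda>_. lborel" by standard
  obtain S where S: "piecewise_polynomial_family S" "\<And>x y. S x y \<ge> 0"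
    "\<And>x y. (\<integral>\<^sup>+z. F x (override_on y z J) \<partial>PiM J (\<lambda>_. lborel)) = S x y"
    using insert.IH insert.prems by blast
  have "S x y = 0" if "\<bar>y i\<bar> > R x" for x y
  proof -
    have "F x (override_on y z J) = 0" for z
      using insert.prems[of i x "override_on y z J"] that insert.hyps by simp
    then show ?thesis using S(2)[of x y] S(3)[of x y] by simp
  qed
  then obtain T where T: "piecewise_polynomial_family T" "\<And>x y. T x y \<ge> 0"
    "\<And>x y. (\<integral>\<^sup>+t. S x (y(i := t)) \<partial>lborel) = T x y"
    using piecewise_polynomial_family_nn_integral[OF S(1,2) R(1,2)] by metis
  have "(\<integral>\<^sup>+z. F x (override_on y z (insert i J)) \<partial>PiM (insert i J) (\<lambda>_. lborel)) = T x y"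
    (is "integral\<^sup>N ?M _ = _") for x y
  proof -
    have "(\<lambda>z. F x (override_on y z (insert i J))) \<in> borel_measurable ?M"
      by (rule piecewise_polynomial_family_measurable[OF F(1) override_on_measurable_PiM])
    then have "(\<integral>\<^sup>+z. F x (override_on y z (insert i J)) \<partial>?M) =
        (\<integral>\<^sup>+t. (\<integral>\<^sup>+z. F x (override_on y (z(i := t)) (insert i J)) \<partial>PiM J (\<lambda>_. lborel)) \<partial>lborel)"
      using insert.hyps by (intro product_nn_integral_insert_rev) auto
    moreover have "override_on y (z(i := t)) (insert i J) = override_on (y(i := t)) z J" for z t
      using insert.hyps by (auto simp: override_on_def fun_eq_iff)
    ultimately show ?thesis by (simp only: S(3) T(3))
  qed
  with T(1,2) show ?case by blast
qed

end

section \<open>Volumes of parametrised polyhedra\<close>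

lemma borel_measurable_vec_lambda:
  "vec_lambda \<in> PiM (UNIV :: 'n::finite set) (\<lambda>_. lborel) \<rightarrow>\<^sub>M (borel :: (real^'n) measure)"
  by (subst borel_measurable_euclidean_space) (auto simp: Basis_vec_def inner_axis)

lemma lborel_eq_distr_vec_lambda:
  "lborel = distr (PiM (UNIV :: 'n::finite set) (\<lambda>_. lborel)) borel (vec_lambda :: _ \<Rightarrow> real^'n)"
proof (rule lborel_eqI)
  interpret product_sigma_finite "\<lambda>_. lborel" by standard
  fix l u :: "real^'n"
  assume le: "\<And>b. b \<in> Basis \<Longrightarrow> l \<bullet> b \<le> u \<bullet> b"
  have vimage: "vec_lambda -` box l u = (\<Pi>\<^sub>E i\<in>UNIV. {l $ i<..<u $ i})"
    by (auto simp: mem_box_cart PiE_iff)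
  have "emeasure (distr (PiM UNIV (\<lambda>_. lborel)) borel vec_lambda) (box l u) =
      (\<Prod>i\<in>UNIV. emeasure lborel {l $ i<..<u $ i})"
    by (simp add: emeasure_distr borel_measurable_vec_lambda space_PiM vimage emeasure_PiM)
  also have "\<dots> = ennreal (\<Prod>i\<in>UNIV. u $ i - l $ i)"
  proof -
    have "l $ i \<le> u $ i" for i
      using le[of "axis i 1"] by (simp add: inner_axis axis_in_Basis_iff)
    then show ?thesis by (simp add: prod_ennreal)
  qed
  also have "(\<Prod>i\<in>UNIV. u $ i - l $ i) = (\<Prod>b\<in>Basis. (u - l) \<bullet> b)"
    by (rule prod.reindex_bij_witness[where i = "\<lambda>b. THE i. b = axis i 1" and j = "\<lambda>i. axis i 1"])
      (auto simp: Basis_vec_def inner_axis axis_eq_axis)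
  finally show "emeasure (distr (PiM UNIV (\<lambda>_. lborel)) borel vec_lambda) (box l u) =
    (\<Prod>b\<in>Basis. (u - l) \<bullet> b)" .
qed simp

definition polyhedron_Int_box ::
    "(('x \<Rightarrow> real^'n) \<times> ('x \<Rightarrow> real)) set \<Rightarrow> ('x \<Rightarrow> real) \<Rightarrow> 'x \<Rightarrow> (real^'n) set" where
  "polyhedron_Int_box K R x =
    {w. (\<forall>(a, b)\<in>K. a x \<bullet> w \<le> b x) \<and> (\<forall>i. \<bar>w $ i\<bar> \<le> R x)}"

lemma closed_polyhedron_Int_box: "closed (polyhedron_Int_box K R x)"
  unfolding polyhedron_Int_box_def Ball_def split_beta
  by (intro closed_Collect_conj closed_Collect_all closed_Collect_imp open_Collect_const
      closed_Collect_le continuous_intros)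

context piecewise_field
begin

lemma piecewise_polynomial_family_indicator_polyhedron_Int_box:
  fixes K :: "(('x \<Rightarrow> real^'n) \<times> ('x \<Rightarrow> real)) set"
  assumes "finite K"
    and "\<And>a b i. (a, b) \<in> K \<Longrightarrow> coefficient (\<lambda>x. a x $ i)"
    and "\<And>a b. (a, b) \<in> K \<Longrightarrow> coefficient b"
    and "coefficient R"
  shows "piecewise_polynomial_family
    (\<lambda>x y. indicat_real (polyhedron_Int_box K R x) (vec_lambda y))"
proof -
  let ?indicator = "\<lambda>x (y :: 'n \<Rightarrow> real).
    if \<forall>i\<in>UNIV. y i - R x \<le> 0 then
      if \<forall>i\<in>UNIV. - R x - y i \<le> 0 then
        if \<forall>k\<in>K. fst k x \<bullet> vec_lambda y - snd k x \<le> 0 then 1 else 0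
      else 0
    else 0"
  have "piecewise_polynomial_family ?indicator"
    using assms
    by (intro piecewise_polynomial_family_If_nonpos piecewise_polynomial_family_const
        affine_family_diff affine_family_coordinate affine_family.const affine_family_inner
        coefficient_minus) auto
  also have "?indicator = (\<lambda>x y. indicat_real (polyhedron_Int_box K R x) (vec_lambda y))"
    by (auto simp: polyhedron_Int_box_def fun_eq_iff abs_le_iff indicator_def split_beta
        minus_le_iff)
  finally show ?thesis .
qed

lemma coefficient_measure_polyhedron_Int_box:
  assumes K: "finite K" "\<And>a b i. (a, b) \<in> K \<Longrightarrow> coefficient (\<lambda>x. a x $ i)"
      "\<And>a b. (a, b) \<in> K \<Longrightarrow> coefficient b"
    and R: "coefficient R" "\<And>x. R x \<ge> 0"
  shows "coefficient (\<lambda>x. measure lebesgue (polyhedron_Int_box K R x))"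
proof -
  let ?Q = "polyhedron_Int_box K R"
  have "\<exists>T. piecewise_polynomial_family T \<and> (\<forall>x y. T x y \<ge> 0 \<and>
      (\<integral>\<^sup>+z. indicat_real (?Q x) (vec_lambda (override_on y z UNIV))
        \<partial>PiM UNIV (\<lambda>_. lborel)) = T x y)"
  proof (rule piecewise_polynomial_family_nn_integral_PiM[OF _ _ _ R])
    show "piecewise_polynomial_family (\<lambda>x y. indicat_real (?Q x) (vec_lambda y))"
      by (intro piecewise_polynomial_family_indicator_polyhedron_Int_box K R(1))
    show "indicat_real (?Q x) (vec_lambda y) = 0" if "\<bar>y i\<bar> > R x" for x y i
      using that by (auto simp: polyhedron_Int_box_def indicator_def not_le)
  qed simp_all
  then obtain T where T: "piecewise_polynomial_family T" "\<And>x y. T x y \<ge> 0"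
    "\<And>x y. (\<integral>\<^sup>+z. indicat_real (?Q x) (vec_lambda (override_on y z UNIV))
      \<partial>PiM UNIV (\<lambda>_. lborel)) = T x y"
    by blast
  have "measure lebesgue (?Q x) = T x (\<lambda>_. 0)" for x
  proof -
    have Q: "?Q x \<in> sets borel" using closed_polyhedron_Int_box by (rule borel_closed)
    then have "emeasure lborel (?Q x) = (\<integral>\<^sup>+w. indicator (?Q x) w \<partial>lborel)" by simp
    also have "\<dots> = (\<integral>\<^sup>+z. indicat_real (?Q x) (vec_lambda z) \<partial>PiM UNIV (\<lambda>_. lborel))"
      unfolding lborel_eq_distr_vec_lambda
      using Q by (subst nn_integral_distr)
        (simp_all add: borel_measurable_vec_lambda ennreal_indicator)
    also have "\<dots> = T x (\<lambda>_. 0)"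
      using T(3)[of x "\<lambda>_. 0"] by (simp add: override_on_def)
    finally show ?thesis
      using Q T(2) by (simp add: measure_def)
  qed
  then show ?thesis
    using piecewise_polynomial_family_coefficient[OF T(1)] by simp
qed

end

interpretation piecewise_rational: piecewise_field piecewise_rational
proof
  fix c f g :: "real^'n \<Rightarrow> real"
  assume "piecewise_rational c" "piecewise_rational f" "piecewise_rational g"
  then show "piecewise_rational (\<lambda>x. if c x > 0 then f x else g x)"
    using piecewise_rational.glue[OF semialgebraic_piecewise_rational_pos] by fastforce
next
  show const: "piecewise_rational (\<lambda>x :: real^'n. r)" for r
    by (intro polyfun_imp_piecewise_rational polyfun.const)
  show "piecewise_rational (\<lambda>x. inverse (f x))" if "piecewise_rational f"
    for f :: "real^'n \<Rightarrow> real"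
    using piecewise_rational_divide[OF const[of 1] that] by (simp add: inverse_eq_divide)
qed (auto intro: piecewise_rational_add piecewise_rational_mult)

section \<open>Prisms over hyperplane sections\<close>

definition prism :: "'a::real_vector set \<Rightarrow> 'a \<Rightarrow> 'a set" where
  "prism S v = {s + t *\<^sub>R v | s t. s \<in> S \<and> t \<in> {0..1}}"

lemma compact_prism:
  fixes v :: "'a::real_normed_vector"
  assumes "compact S"
  shows "compact (prism S v)"
proof -
  have "prism S v = (\<lambda>(s, t). s + t *\<^sub>R v) ` (S \<times> {0..1})" by (force simp: prism_def)
  also have "compact \<dots>"
    using assms by (intro compact_continuous_image compact_Times)
      (auto simp: case_prod_beta intro!: continuous_intros)
  finally show ?thesis .
qed

lemma mem_prism_scaleR_iff:
  fixes v :: "'a::real_inner"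
  assumes "S \<subseteq> {y. v \<bullet> y = 0}" "v \<noteq> 0" "b \<ge> 0" "v \<bullet> s = 0"
  shows "s + t *\<^sub>R v \<in> prism S (b *\<^sub>R v) \<longleftrightarrow> s \<in> S \<and> t \<in> {0..b}"
proof
  assume "s + t *\<^sub>R v \<in> prism S (b *\<^sub>R v)"
  then obtain s' t' where eq: "s + t *\<^sub>R v = s' + (t' * b) *\<^sub>R v" and "s' \<in> S" "t' \<in> {0..1}"
    by (auto simp: prism_def)
  moreover have "v \<bullet> s' = 0" using assms(1) \<open>s' \<in> S\<close> by auto
  then have "t = t' * b"
    using arg_cong[OF eq, of "inner v"] assms(2,4) by (simp add: inner_add_right)
  ultimately show "s \<in> S \<and> t \<in> {0..b}"
    using assms(3) by (auto intro: mult_left_le_one_le)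
next
  assume "s \<in> S \<and> t \<in> {0..b}"
  moreover from this have "t = (t / b) * b" by (cases "b = 0") auto
  ultimately show "s + t *\<^sub>R v \<in> prism S (b *\<^sub>R v)"
    unfolding prism_def
    by (intro CollectI exI[of _ s] exI[of _ "t / b"]) (auto simp: divide_le_eq_1)
qed

lemma emeasure_line_Int_prism:
  fixes v :: "'a::real_inner"
  assumes "S \<subseteq> {y. v \<bullet> y = 0}" "v \<noteq> 0" "b \<ge> 0" "w \<in> prism S (a *\<^sub>R v)"
  shows "emeasure lborel {t. w + t *\<^sub>R v \<in> prism S (b *\<^sub>R v)} = ennreal b"
proof -
  obtain s c where w: "w = s + c *\<^sub>R v" "s \<in> S"
    using assms(4) by (auto simp: prism_def)
  then have "v \<bullet> s = 0" using assms(1) by auto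
  then have "w + t *\<^sub>R v \<in> prism S (b *\<^sub>R v) \<longleftrightarrow> t \<in> {- c..b - c}" for t
    using mem_prism_scaleR_iff[OF assms(1-3), of s "c + t"] w by (auto simp: algebra_simps)
  then have "{t. w + t *\<^sub>R v \<in> prism S (b *\<^sub>R v)} = {- c..b - c}" by blast
  then show ?thesis using assms(3) by simp
qed

lemma nn_integral_emeasure_lines_commute:
  fixes v :: "'a::euclidean_space"
  assumes [measurable]: "A \<in> sets borel" "B \<in> sets borel"
  shows "(\<integral>\<^sup>+w. indicator A w * emeasure lborel {t. w + t *\<^sub>R v \<in> B} \<partial>lborel) =
    (\<integral>\<^sup>+w. indicator B w * emeasure lborel {t. w + t *\<^sub>R v \<in> A} \<partial>lborel)"
proof -
  have emeasure_line: "indicator X w * emeasure lborel {t. w + t *\<^sub>R v \<in> Y} =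
      (\<integral>\<^sup>+t. indicator X w * indicator Y (w + t *\<^sub>R v) \<partial>lborel)"
    if [measurable]: "Y \<in> sets borel" for X Y and w :: 'a
  proof -
    have "{t. w + t *\<^sub>R v \<in> Y} \<in> sets borel" by measurable
    moreover have "indicator Y (w + t *\<^sub>R v) = (indicator {t. w + t *\<^sub>R v \<in> Y} t :: ennreal)" for t
      by (simp add: indicator_def)
    ultimately show ?thesis by (simp add: nn_integral_cmult)
  qed
  have "(\<integral>\<^sup>+w. \<integral>\<^sup>+t. indicator A w * indicator B (w + t *\<^sub>R v) \<partial>lborel \<partial>lborel) =
      (\<integral>\<^sup>+t. \<integral>\<^sup>+w. indicator A w * indicator B (w + t *\<^sub>R v) \<partial>lborel \<partial>lborel)"
    by (rule lborel_pair.Fubini') measurable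
  also have "\<dots> = (\<integral>\<^sup>+t. \<integral>\<^sup>+w. indicator B w * indicator A (w + (- t) *\<^sub>R v) \<partial>lborel \<partial>lborel)"
  proof (rule nn_integral_cong)
    fix t
    show "(\<integral>\<^sup>+w. indicator A w * indicator B (w + t *\<^sub>R v) \<partial>lborel) =
      (\<integral>\<^sup>+w. indicator B w * indicator A (w + (- t) *\<^sub>R v) \<partial>lborel)"
      by (subst lborel_distr_plus[of "- t *\<^sub>R v", symmetric], subst nn_integral_distr)
        (auto simp: mult.commute add.commute)
  qed
  also have "\<dots> = (\<integral>\<^sup>+t. \<integral>\<^sup>+w. indicator B w * indicator A (w + t *\<^sub>R v) \<partial>lborel \<partial>lborel)"
    by (subst (2) lborel_distr_uminus[symmetric], subst nn_integral_distr) auto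
  also have "\<dots> = (\<integral>\<^sup>+w. \<integral>\<^sup>+t. indicator B w * indicator A (w + t *\<^sub>R v) \<partial>lborel \<partial>lborel)"
    by (rule lborel_pair.Fubini') measurable
  finally show ?thesis by (simp add: emeasure_line)
qed

text \<open>Lines in direction \<open>v\<close> that meet a prism over \<open>S\<close> all meet it in segments of the same
  length. So the symmetric expression above, evaluated for two prisms over \<open>S\<close>, is the volume of
  either one times the height of the other.\<close>

lemma measure_prism_scaleR:
  fixes v :: "'a::euclidean_space"
  assumes "compact S" "S \<subseteq> {y. v \<bullet> y = 0}" "v \<noteq> 0" "r \<ge> 0"
  shows "measure lebesgue (prism S (r *\<^sub>R v)) = r * measure lebesgue (prism S v)"
proof -
  let ?Q = "\<lambda>a. prism S (a *\<^sub>R v)"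
  have borel: "?Q a \<in> sets borel" for a
    by (intro borel_compact compact_prism assms(1))
  have volume_times_height:
    "(\<integral>\<^sup>+w. indicator (?Q a) w * emeasure lborel {t. w + t *\<^sub>R v \<in> ?Q b} \<partial>lborel) =
      ennreal b * emeasure lborel (?Q a)" if "b \<ge> 0" for a b
  proof -
    have "indicator (?Q a) w * emeasure lborel {t. w + t *\<^sub>R v \<in> ?Q b} =
        ennreal b * indicator (?Q a) w" for w
      using emeasure_line_Int_prism[OF assms(2,3) that, of w a] by (simp add: indicator_def)
    then show ?thesis using borel by (simp add: nn_integral_cmult)
  qed
  have "ennreal 1 * emeasure lborel (?Q r) = ennreal r * emeasure lborel (?Q 1)"
    using nn_integral_emeasure_lines_commute[OF borel borel, of r v 1]
    by (simp only: volume_times_height assms(4) zero_le_one)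
  then show ?thesis
    using borel[of 1] borel[of r] assms(4) by (simp add: measure_def enn2real_mult)
qed

lemma one_le_radial_IB_iff:
  fixes x :: "real^'n"
  assumes "compact P" "x \<noteq> 0"
  shows "radial_IB P x \<ge> 1 \<longleftrightarrow> measure lebesgue (prism (P \<inter> orth_hyperplane x) x) \<ge> x \<bullet> x"
proof -
  let ?S = "P \<inter> orth_hyperplane x" and ?u = "x /\<^sub>R norm x"
  have "compact ?S"
    unfolding orth_hyperplane_def by (intro compact_Int_closed assms(1) closed_hyperplane)
  moreover have "?S \<subseteq> {y. ?u \<bullet> y = 0}" by (auto simp: orth_hyperplane_def)
  ultimately have "measure lebesgue (prism ?S (norm x *\<^sub>R ?u)) =
      norm x * measure lebesgue (prism ?S ?u)"
    using assms(2) by (intro measure_prism_scaleR) auto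
  then have "measure lebesgue (prism ?S x) = norm x * hyperplane_volume x ?S"
    using assms(2) by (simp add: hyperplane_volume_def prism_def)
  moreover have "x \<bullet> x = norm x * norm x" by (simp add: dot_square_norm power2_eq_square)
  ultimately show ?thesis using assms(2) by (simp add: radial_IB_def)
qed

definition section_prism_halfspaces ::
    "((real^'n) \<times> real) set \<Rightarrow> ((real^'n \<Rightarrow> real^'n) \<times> (real^'n \<Rightarrow> real)) set" where
  "section_prism_halfspaces C = {(\<lambda>x. - x, \<lambda>x. 0), (\<lambda>x. x, \<lambda>x. x \<bullet> x)} \<union>
    (\<lambda>(a, \<beta>). (\<lambda>x. (x \<bullet> x) *\<^sub>R a - (x \<bullet> a) *\<^sub>R x, \<lambda>x. \<beta> * (x \<bullet> x))) ` C"

text \<open>A point \<open>w\<close> lies in the prism iff its component along \<open>x\<close> is between \<open>0\<close> and \<open>x\<close> and its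
  orthogonal projection to \<open>x\<^sup>\<perp>\<close> satisfies the inequalities in \<open>C\<close>, here cleared of the
  denominator \<open>x \<bullet> x\<close>.\<close>

lemma prism_section_eq_halfspaces:
  fixes x :: "real^'n"
  assumes "x \<noteq> 0"
  shows "prism ({y. \<forall>(a, \<beta>)\<in>C. a \<bullet> y \<le> \<beta>} \<inter> orth_hyperplane x) x =
    {w. \<forall>(a, b)\<in>section_prism_halfspaces C. a x \<bullet> w \<le> b x}"
  (is "prism ?S x = ?B")
proof -
  have pos: "x \<bullet> x > 0" using assms by simp
  have mem_halfspaces_iff: "w \<in> ?B \<longleftrightarrow> 0 \<le> x \<bullet> w \<and> x \<bullet> w \<le> x \<bullet> x \<and>
      (\<forall>(a, \<beta>)\<in>C. (x \<bullet> x) * (a \<bullet> w) - (x \<bullet> a) * (x \<bullet> w) \<le> \<beta> * (x \<bullet> x))" for w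
    by (auto simp: section_prism_halfspaces_def inner_diff_left)
  show ?thesis
  proof (rule set_eqI)
    fix w
    define t where "t = (x \<bullet> w) / (x \<bullet> x)"
    define s where "s = w - t *\<^sub>R x"
    have w: "w = s + t *\<^sub>R x" and s: "x \<bullet> s = 0"
      using pos by (simp_all add: s_def t_def inner_diff_right)
    have "(x \<bullet> x) * (a \<bullet> w) - (x \<bullet> a) * (x \<bullet> w) = (a \<bullet> s) * (x \<bullet> x)" for a
      by (simp add: w s inner_add_right inner_commute[of x a] algebra_simps)
    moreover have "x \<bullet> w = t * (x \<bullet> x)" by (simp add: w s inner_add_right)
    moreover have "0 \<le> t * (x \<bullet> x) \<longleftrightarrow> 0 \<le> t" "t * (x \<bullet> x) \<le> x \<bullet> x \<longleftrightarrow> t \<le> 1"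
      using mult_le_cancel_right_pos[OF pos, of 0 t] mult_le_cancel_right_pos[OF pos, of t 1]
      by simp_all
    ultimately have "w \<in> ?B \<longleftrightarrow> s \<in> ?S \<and> t \<in> {0..1}"
      unfolding mem_halfspaces_iff using s pos by (auto simp: orth_hyperplane_def)
    moreover have "?S \<subseteq> {y. x \<bullet> y = 0}" by (auto simp: orth_hyperplane_def)
    ultimately show "w \<in> prism ?S x \<longleftrightarrow> w \<in> ?B"
      using mem_prism_scaleR_iff[of ?S x 1 s t] assms s by (simp add: w)
  qed
qed

lemma polyhedron_eq_halfspace_pairs:
  fixes P :: "'a::euclidean_space set"
  assumes "polyhedron P"
  obtains C where "finite C" "P = {y. \<forall>(a, \<beta>)\<in>C. a \<bullet> y \<le> \<beta>}"
proof -
  obtain F where F: "finite F" "P = \<Inter> F" "\<forall>h\<in>F. \<exists>a b. h = {x. a \<bullet> x \<le> b}"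
    using assms unfolding polyhedron_def by metis
  then obtain a b where ab: "\<And>h. h \<in> F \<Longrightarrow> h = {x. a h \<bullet> x \<le> b h}" by metis
  have "P = {y. \<forall>(c, \<beta>)\<in>(\<lambda>h. (a h, b h)) ` F. c \<bullet> y \<le> \<beta>}"
    unfolding F(2) using ab by auto
  with that F(1) show thesis by blast
qed

lemma norm_prism_le:
  assumes "\<And>s. s \<in> S \<Longrightarrow> norm s \<le> B" "w \<in> prism S x"
  shows "norm w \<le> B + norm x"
proof -
  obtain s t where w: "w = s + t *\<^sub>R x" "s \<in> S" "0 \<le> t" "t \<le> 1"
    using assms(2) by (auto simp: prism_def)
  have "norm w \<le> norm s + t * norm x"
    using norm_triangle_ineq[of s "t *\<^sub>R x"] w by simp
  also have "\<dots> \<le> B + norm x"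
    using w assms(1) by (intro add_mono mult_left_le_one_le) auto
  finally show ?thesis .
qed

lemma polyfun_section_prism_halfspaces:
  assumes "(a, b) \<in> section_prism_halfspaces C"
  shows "polyfun (\<lambda>x. a x $ i)" "polyfun b"
  using assms
  by (auto simp: section_prism_halfspaces_def
      intro!: polyfun_minus polyfun_diff polyfun_inner polyfun.intros)

lemma polyhedron_Int_box_eq_prism_section:
  fixes x :: "real^'n"
  assumes "x \<noteq> 0" "\<And>y. y \<in> P \<Longrightarrow> norm y \<le> B" "P = {y. \<forall>(a, \<beta>)\<in>C. a \<bullet> y \<le> \<beta>}"
  shows "polyhedron_Int_box (section_prism_halfspaces C) (\<lambda>x. B + 1 + x \<bullet> x) x =
    prism (P \<inter> orth_hyperplane x) x"
proof -
  have "\<bar>w $ i\<bar> \<le> B + 1 + x \<bullet> x" if "w \<in> prism (P \<inter> orth_hyperplane x) x" for w i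
  proof -
    have "norm w \<le> B + norm x" using assms(2) that by (intro norm_prism_le) auto
    moreover have "2 * norm x \<le> 1 + x \<bullet> x"
      using zero_le_power2[of "norm x - 1"] by (simp add: power2_diff power2_norm_eq_inner)
    ultimately show ?thesis
      using component_le_norm_cart[of w i] norm_ge_zero[of x] by linarith
  qed
  then show ?thesis
    unfolding polyhedron_Int_box_def assms(3) prism_section_eq_halfspaces[OF assms(1)] by blast
qed

lemma piecewise_rational_measure_prism_section:
  fixes P :: "(real^'n) set"
  assumes "polyhedron P" "bounded P"
  shows "piecewise_rational (\<lambda>x. measure lebesgue (prism (P \<inter> orth_hyperplane x) x))"
proof -
  obtain C where C: "finite C" "P = {y. \<forall>(a, \<beta>)\<in>C. a \<bullet> y \<le> \<beta>}"
    using polyhedron_eq_halfspace_pairs[OF assms(1)] by blast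
  obtain B where B: "B > 0" "\<And>y. y \<in> P \<Longrightarrow> norm y \<le> B"
    using assms(2) by (auto simp: bounded_pos)
  let ?Q = "polyhedron_Int_box (section_prism_halfspaces C) (\<lambda>x. B + 1 + x \<bullet> x)"
  let ?V = "\<lambda>x. if x \<in> {0} then measure lebesgue (prism (P \<inter> orth_hyperplane 0) 0)
    else measure lebesgue (?Q x)"
  have "piecewise_rational (\<lambda>x. measure lebesgue (?Q x))"
  proof (rule piecewise_rational.coefficient_measure_polyhedron_Int_box)
    show "finite (section_prism_halfspaces C)"
      using C(1) by (simp add: section_prism_halfspaces_def)
    show "piecewise_rational (\<lambda>x :: real^'n. B + 1 + x \<bullet> x)"
      by (intro polyfun_imp_piecewise_rational polyfun_inner polyfun.intros)
    show "B + 1 + x \<bullet> x \<ge> 0" for x :: "real^'n"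
      using B(1) by simp
  qed (auto intro: polyfun_imp_piecewise_rational polyfun_section_prism_halfspaces)
  then have "piecewise_rational ?V"
    by (intro piecewise_rational.glue semialgebraic_singleton_zero
        piecewise_rational.coefficient_const)
  also have "?V = (\<lambda>x. measure lebesgue (prism (P \<inter> orth_hyperplane x) x))"
    by (auto simp: polyhedron_Int_box_eq_prism_section[OF _ B(2) C(2)])
  finally show ?thesis .
qed

theorem theorem2p6:
  fixes P :: "(real^'n) set"
  assumes "polytope P" and "interior P \<noteq> {}" and "0 \<in> P"
  shows "semialgebraic (intersection_body P)"
proof -
  let ?V = "\<lambda>x. measure lebesgue (prism (P \<inter> orth_hyperplane x) x)"
  have "piecewise_rational ?V"
    using assms(1)
    by (intro piecewise_rational_measure_prism_section polytope_imp_polyhedron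
        polytope_imp_bounded)
  then have "semialgebraic ({x. ?V x \<ge> x \<bullet> x} \<union> {0})"
    by (intro semialgebraic.union semialgebraic_piecewise_rational_le semialgebraic_singleton_zero
        polyfun_imp_piecewise_rational[of "\<lambda>x. x \<bullet> x"] polyfun_inner polyfun.coord)
  also have "{x. ?V x \<ge> x \<bullet> x} \<union> {0} = intersection_body P"
    using one_le_radial_IB_iff[OF polytope_imp_compact[OF assms(1)]]
    by (auto simp: intersection_body_def)
  finally show ?thesis .
qed

end
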